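(* Let $\mathcal C\le\mathbb F_{q^m}^n$ be an $\mathbb F_{q^m}$-linear rank metric code with generating matrix $G\in\mathbb F_{q^m}^{k\times n}$, $\mathcal M_{\mathcal C}$ its associated $q$-matroid and $P(\mathcal M_{\mathcal C})$ the projectivization matroid of $\mathcal M_{\mathcal C}$. Let $N=\frac{q^n-1}{q-1}$, let $H\in\mathbb F_q^{n\times N}$ be a matrix whose columns are representatives of the $N$ distinct points of $\mathbb P\mathbb F_q^n$, let $\mathcal C^H=\mathrm{rowsp}_{\mathbb F_{q^m}}(GH)$, and let $M_{\mathcal C^H}$ be the matroid induced by $\mathcal C^H$. Then $P(\mathcal M_{\mathcal C})\cong M_{\mathcal C^H}$ as matroids.
   Context: $\mathbb F_{q^m}$ is the degree-$m$ extension of $\mathbb F_q$. A generating matrix of $\mathcal C$ is a matrix over $\mathbb F_{q^m}$ whose row space is $\mathcal C$. The associated $q$-matroid is $\mathcal M_{\mathcal C}=(\mathbb F_q^n,\rho)$ with $\rho(V)=\mathrm{rk}_{\mathbb F_{q^m}}(G\,Y_V)$, where $Y_V$ is any matrix over $\mathbb F_q$ whose column space is $V$. For a code with generating matrix $G'\in\mathbb F_{q^m}^{k\times N}$, the induced matroid is $([N],r)$ with $r(A)$ the $\mathbb F_{q^m}$-rank of the submatrix of $G'$ formed by the columns indexed by $A$. $\mathbb P\mathbb F_q^n$ is the set of lines of $\mathbb F_q^n$; the projectivization matroid of a $q$-matroid $(E,\rho)$ is $(\mathbb PE,r)$ with $r(S)=\rho(\langle S\rangle)$, $\langle S\rangle$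 the span of the union of lines in $S$. Two matroids are equivalent ($\cong$) if there is a bijection between their groundsets preserving rank. *)

theory Defs
  imports "Jordan_Normal_Form.DL_Rank" "Jordan_Normal_Form.DL_Submatrix" "HOL-Library.Cardinality"
begin

text \<open>Matrices and vectors are those of \<open>Jordan_Normal_Form\<close>, hence indexed from 0; in particular
  the groundset \<open>[N]\<close> is represented by \<open>{..<N}\<close>. Subspaces, spans and dimensions in \<open>K\<^sup>n\<close> refer to
  the vector space \<open>module_vec TYPE('a) n\<close>.\<close>

abbreviation vspan :: "nat \<Rightarrow> 'a::field vec set \<Rightarrow> 'a vec set" where
  "vspan n S \<equiv> LinearCombinations.module.span class_ring (module_vec TYPE('a) n) S"

abbreviation is_subspace :: "nat \<Rightarrow> 'a::field vec set \<Rightarrow> bool" where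
  "is_subspace n W \<equiv> VectorSpace.subspace class_ring W (module_vec TYPE('a) n)"

abbreviation subspace_dim :: "nat \<Rightarrow> 'a::field vec set \<Rightarrow> nat" where
  "subspace_dim n W \<equiv> vectorspace.dim class_ring ((module_vec TYPE('a) n)\<lparr>carrier := W\<rparr>)"

abbreviation mat_rank :: "'a::field mat \<Rightarrow> nat" where
  "mat_rank A \<equiv> vec_space.rank (dim_row A) A"

text \<open>The number of rows of a generating matrix is arbitrary; they need not be independent.\<close>

definition generating_matrix :: "nat \<Rightarrow> 'a::field mat \<Rightarrow> 'a vec set \<Rightarrow> bool" where
  "generating_matrix n G C \<longleftrightarrow> dim_col G = n \<and> vec_space.row_space n G = C"

text \<open>Matroids and \<open>q\<close>-matroids are given by a groundset (ground space) and a rank function, of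
  which only the values on subsets of the groundset (subspaces of the ground space) matter.\<close>

type_synonym 'a matroid = "'a set \<times> ('a set \<Rightarrow> nat)"
type_synonym 'q q_matroid = "'q vec set \<times> ('q vec set \<Rightarrow> nat)"

definition is_matroid :: "'a matroid \<Rightarrow> bool" where
  "is_matroid M \<longleftrightarrow> (case M of (E, r) \<Rightarrow>
     finite E \<and>
     (\<forall>A. A \<subseteq> E \<longrightarrow> r A \<le> card A) \<and>
     (\<forall>A B. A \<subseteq> B \<and> B \<subseteq> E \<longrightarrow> r A \<le> r B) \<and>
     (\<forall>A B. A \<subseteq> E \<and> B \<subseteq> E \<longrightarrow> r (A \<union> B) + r (A \<inter> B) \<le> r A + r B))"

definition matroid_equiv :: "'a matroid \<Rightarrow> 'b matroid \<Rightarrow> bool" where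
  "matroid_equiv M M' \<longleftrightarrow> is_matroid M \<and> is_matroid M' \<and>
     (\<exists>\<phi>. bij_betw \<phi> (fst M) (fst M') \<and> (\<forall>A. A \<subseteq> fst M \<longrightarrow> snd M' (\<phi> ` A) = snd M A))"

definition induced_matroid :: "'a::field mat \<Rightarrow> nat matroid" where
  "induced_matroid G' = ({..<dim_col G'}, \<lambda>A. mat_rank (submatrix G' UNIV A))"

text \<open>In the following, \<open>emb\<close> is the inclusion of the small field into the large one. The rank of
  \<open>G Y\<close> depends only on the column space \<open>V\<close> of \<open>Y\<close>, so the choice of \<open>Y\<close> is immaterial.\<close>

definition assoc_q_matroid :: "('q::field \<Rightarrow> 'e::field) \<Rightarrow> 'e mat \<Rightarrow> 'q q_matroid" where
  "assoc_q_matroid emb G = (let n = dim_col G in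
     (carrier_vec n,
      \<lambda>V. mat_rank (G * map_mat emb (SOME Y. dim_row Y = n \<and> vec_space.col_space n Y = V))))"

definition lines_in :: "nat \<Rightarrow> 'a::field vec set \<Rightarrow> 'a vec set set" where
  "lines_in n E = {L. is_subspace n L \<and> subspace_dim n L = 1 \<and> L \<subseteq> E}"

text \<open>Here \<open>n\<close> is the dimension of the coordinate space that contains the ground space.\<close>

definition projectivization :: "nat \<Rightarrow> 'q::field q_matroid \<Rightarrow> 'q vec set matroid" where
  "projectivization n M = (lines_in n (fst M), \<lambda>S. snd M (vspan n (\<Union>S)))"

text \<open>Every point of the projective space is spanned by exactly one column of \<open>H\<close>.\<close>

definition point_representatives :: "nat \<Rightarrow> 'q::field mat \<Rightarrow> bool" where
  "point_representatives n H \<longleftrightarrow> dim_row H = n \<and>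
     bij_betw (\<lambda>j. vspan n {col H j}) {..<dim_col H} (lines_in n (carrier_vec n))"

end

theory Submission
  imports Defs "Jordan_Normal_Form.Matrix_Kernel"
begin

text \<open>Sending \<open>j\<close> to the line spanned by the \<open>j\<close>-th column of \<open>H\<close> identifies the two groundsets.
  A set \<open>S\<close> of lines with index set \<open>A\<close> spans the column space of the submatrix \<open>H\<^sub>A\<close>, so \<open>H\<^sub>A\<close> is an
  admissible choice for \<open>Y\<close> and \<open>G H\<^sub>A = (G H)\<^sub>A\<close> computes the rank of \<open>S\<close>. Replacing \<open>G H\<close> by another
  generating matrix \<open>G'\<close> does not matter: the kernel of a matrix is the orthogonal complement of its
  row space, hence \<open>(G H)\<^sub>A\<close> and \<open>G'\<^sub>A\<close> have the same kernel and, by rank-nullity, the same rank.\<close>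

section \<open>Dimension of spans and the matroid axioms\<close>

lemma (in vectorspace) dim_span_empty: "vectorspace.dim K (span_vs {}) = 0"
proof -
  have "maximal {} (\<lambda>T. T \<subseteq> {} \<and> lin_indpt T)"
    unfolding maximal_def lin_dep_def by auto
  from dim_span[OF _ _ this] show ?thesis by simp
qed

text \<open>Dimension is the size of a maximal independent subset \<open>U\<close> of
  \<open>S\<close>; a vector outside the span of \<open>S\<close> enlarges \<open>U\<close> to such
  a subset of \<open>insert x S\<close>. This dichotomy is the one that
  \<open>is_matroid_closureI\<close> asks for.\<close>

lemma (in vectorspace) dim_span_insert:
  assumes S: "S \<subseteq> carrier V" "finite S" and x: "x \<in> carrier V"
  shows "vectorspace.dim K (span_vs (insert x S)) =
    (if x \<in> span S then vectorspace.dim K (span_vs S) else Suc (vectorspace.dim K (span_vs S)))"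
proof (cases "x \<in> span S")
  case True
  then show ?thesis using already_in_span[OF S(1) True] by simp
next
  case False
  have "lin_indpt {}" unfolding lin_dep_def by auto
  then obtain U where U: "maximal U (\<lambda>T. T \<subseteq> S \<and> lin_indpt T)"
    using maximal_exists_superset[OF S(2), of "\<lambda>T. T \<subseteq> S \<and> lin_indpt T" "{}"] by blast
  then have US: "U \<subseteq> S" and liU: "lin_indpt U"
    and maxU: "\<And>W. U \<subseteq> W \<Longrightarrow> W \<subseteq> S \<Longrightarrow> lin_indpt W \<Longrightarrow> W = U"
    unfolding maximal_def by auto
  have "x \<notin> S" using False span_mem[OF S(1)] by blast
  then have xU: "x \<notin> U" using US by blast
  have "x \<notin> span U" using False span_is_monotone[OF US] by blast
  then have li: "lin_indpt (insert x U)"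
    using lin_dep_iff_in_span[OF _ liU x xU] US S(1) by auto
  have "maximal (insert x U) (\<lambda>T. T \<subseteq> insert x S \<and> lin_indpt T)"
    unfolding maximal_def
  proof (intro conjI allI impI)
    fix W assume W: "insert x U \<subseteq> W \<and> W \<subseteq> insert x S \<and> lin_indpt W"
    \<comment> \<open>Without \<open>x\<close>, the competitor \<open>W\<close> lies between
      \<open>U\<close> and \<open>S\<close>, so the maximality of \<open>U\<close> applies.\<close>
    then have "lin_indpt (W - {x})" by (meson subset_li_is_li Diff_subset)
    then have "W - {x} = U" using W xU by (intro maxU) auto
    then show "W = insert x U" using W by auto
  qed (use US li in auto)
  from dim_span[OF _ _ this] have "vectorspace.dim K (span_vs (insert x S)) = card (insert x U)"
    using S x by auto
  also have "\<dots> = Suc (card U)" using xU finite_subset[OF US S(2)] by simp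
  also have "card U = vectorspace.dim K (span_vs S)" using dim_span[OF S U] by simp
  finally show ?thesis using False by simp
qed

text \<open>Here \<open>cl x A\<close> stands for \<open>x\<close> being in the closure of \<open>A\<close>. Submodularity holds because adding
  elements one by one raises the rank of a larger set no more often than that of a smaller one.\<close>

lemma is_matroid_closureI:
  assumes fin: "finite E" and empty: "r {} = 0"
    and mono: "\<And>A B x. A \<subseteq> B \<Longrightarrow> B \<subseteq> E \<Longrightarrow> x \<in> E \<Longrightarrow> cl x A \<Longrightarrow> cl x B"
    and insert: "\<And>A x. A \<subseteq> E \<Longrightarrow> x \<in> E \<Longrightarrow> r (insert x A) = (if cl x A then r A else Suc (r A))"
  shows "is_matroid (E, r)"
proof -
  have card: "r A \<le> card A" if "A \<subseteq> E" for A
    using finite_subset[OF that fin] that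
  proof (induction A rule: finite_induct)
    case (insert x A)
    then show ?case using assms(4)[of A x] by auto
  qed (simp add: empty)
  \<comment> \<open>The gain in rank from adding \<open>C\<close> is no larger over \<open>B\<close>
    than over \<open>A\<close>; sums avoid truncated subtraction. The first conjunct gives
    monotonicity.\<close>
  have diff: "r A \<le> r (A \<union> C) \<and> r (B \<union> C) + r A \<le> r (A \<union> C) + r B"
    if "A \<subseteq> B" "B \<subseteq> E" "C \<subseteq> E" for A B C
    using finite_subset[OF that(3) fin] that(3)
  proof (induction C rule: finite_induct)
    case (insert x C)
    have AC: "A \<union> C \<subseteq> B \<union> C" "B \<union> C \<subseteq> E" "A \<union> C \<subseteq> E" "x \<in> E"
      using that insert.prems by auto
    have "cl x (A \<union> C) \<Longrightarrow> cl x (B \<union> C)" using mono[OF AC(1,2,4)] .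
    then show ?case
      using insert.IH insert.prems assms(4)[OF AC(2,4)] assms(4)[OF AC(3,4)]
      by (auto split: if_splits)
  qed simp
  have le: "r A \<le> r B" if "A \<subseteq> B" "B \<subseteq> E" for A B
    using diff[of A A B] that by (simp add: Un_absorb1)
  \<comment> \<open>\<open>B\<close> is added to \<open>A\<close> and to its subset
    \<open>A \<inter> B\<close>, which \<open>B\<close> absorbs.\<close>
  have "r (A \<union> B) + r (A \<inter> B) \<le> r A + r B" if "A \<subseteq> E" "B \<subseteq> E" for A B
    using diff[of "A \<inter> B" A B] that by (simp add: Un_absorb1 add.commute)
  then show ?thesis
    unfolding is_matroid_def using fin card le by simp
qed

section \<open>Transport along a bijection\<close>

text \<open>Every subset of \<open>F\<close> is the image of a subset of \<open>E\<close>, and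
  injectivity preserves cardinalities, inclusions and intersections, so all axioms carry
  over.\<close>

lemma is_matroid_bij:
  assumes M: "is_matroid (E, r)" and bij: "bij_betw \<psi> E F"
    and rank: "\<And>A. A \<subseteq> E \<Longrightarrow> s (\<psi> ` A) = r A"
  shows "is_matroid (F, s)"
proof -
  have inj: "inj_on \<psi> E" and im: "F = \<psi> ` E" using bij by (auto simp: bij_betw_def)
  have sub: "\<exists>A\<subseteq>E. X = \<psi> ` A" if "X \<subseteq> F" for X
    using that im by (meson subset_imageE)
  have card: "card (\<psi> ` A) = card A" if "A \<subseteq> E" for A
    using card_image inj_on_subset[OF inj that] by blast
  have ax: "finite E" "\<And>A. A \<subseteq> E \<Longrightarrow> r A \<le> card A"
    "\<And>A B. A \<subseteq> B \<Longrightarrow> B \<subseteq> E \<Longrightarrow> r A \<le> r B"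
    "\<And>A B. A \<subseteq> E \<Longrightarrow> B \<subseteq> E \<Longrightarrow> r (A \<union> B) + r (A \<inter> B) \<le> r A + r B"
    using M by (auto simp: is_matroid_def)
  have "s X \<le> card X" if "X \<subseteq> F" for X
    using sub[OF that] ax(2) card rank by force
  moreover have "s X \<le> s Y" if XY: "X \<subseteq> Y" "Y \<subseteq> F" for X Y
  proof -
    obtain A B where AB: "A \<subseteq> E" "X = \<psi> ` A" "B \<subseteq> E" "Y = \<psi> ` B"
      using sub XY by (meson subset_trans)
    then have "A \<subseteq> B" using XY inj unfolding inj_on_def by blast
    then show ?thesis using AB rank ax(3) by simp
  qed
  moreover have "s (X \<union> Y) + s (X \<inter> Y) \<le> s X + s Y" if XY: "X \<subseteq> F" "Y \<subseteq> F" for X Y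
  proof -
    obtain A B where AB: "A \<subseteq> E" "X = \<psi> ` A" "B \<subseteq> E" "Y = \<psi> ` B"
      using sub XY by meson
    have "X \<union> Y = \<psi> ` (A \<union> B)" "X \<inter> Y = \<psi> ` (A \<inter> B)"
      using AB inj by (auto simp: inj_on_image_Int image_Un)
    then show ?thesis using AB rank[of A] rank[of B] rank[of "A \<union> B"] rank[of "A \<inter> B"] ax(4)[of A B]
      by (simp add: le_infI1)
  qed
  ultimately show ?thesis using ax(1) im unfolding is_matroid_def by simp
qed

text \<open>The natural map sends column indices to lines, while the desired equivalence starts at
  the lines; hence the inverse of \<open>\<psi>\<close> is the witness. Only the matroid on
  \<open>E\<close> has to be verified, as the axioms for \<open>F\<close> are transported.\<close>

lemma matroid_equiv_bijI:
  assumes M: "is_matroid (E, r)" and bij: "bij_betw \<psi> E F"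
    and rank: "\<And>A. A \<subseteq> E \<Longrightarrow> s (\<psi> ` A) = r A"
  shows "matroid_equiv (F, s) (E, r)"
proof -
  have inj: "inj_on \<psi> E" and im: "F = \<psi> ` E" using bij by (auto simp: bij_betw_def)
  have "r (the_inv_into E \<psi> ` X) = s X" if "X \<subseteq> F" for X
  proof -
    obtain A where A: "A \<subseteq> E" "X = \<psi> ` A" using \<open>X \<subseteq> F\<close> im by (meson subset_imageE)
    have "the_inv_into E \<psi> ` X = (\<lambda>x. x) ` A"
      unfolding A(2) image_image using A(1) the_inv_into_f_f[OF inj] by (intro image_cong) auto
    then have "the_inv_into E \<psi> ` X = A" by simp
    then show ?thesis using A rank by simp
  qed
  then show ?thesis
    unfolding matroid_equiv_def
    using M is_matroid_bij[OF assms] bij_betw_the_inv_into[OF bij] by auto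
qed

section \<open>Column selection\<close>

lemma submatrix_mult_UNIV:
  "submatrix (A * B) UNIV J = A * submatrix B UNIV J"
  by (rule eq_matI)
    (auto simp: submatrix_def pick_UNIV scalar_prod_def row_def col_def pick_le intro!: sum.cong)

lemma map_mat_submatrix: "map_mat f (submatrix A I J) = submatrix (map_mat f A) I J"
  by (rule eq_matI) (auto simp: submatrix_def pick_le)

lemma submatrix_carrier_mat:
  "submatrix A UNIV J \<in> carrier_mat (dim_row A) (card {j. j < dim_col A \<and> j \<in> J})"
  by (intro carrier_matI) (simp_all add: dim_submatrix)

lemma col_submatrix:
  assumes "j < card {j. j < dim_col A \<and> j \<in> J}"
  shows "col (submatrix A UNIV J) j = col A (pick J j)"
  using assms by (intro eq_vecI) (auto simp: submatrix_def pick_UNIV pick_le)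

lemma set_cols_submatrix:
  assumes J: "J \<subseteq> {..<dim_col A}"
  shows "set (cols (submatrix A UNIV J)) = col A ` J"
proof -
  let ?c = "card {j. j < dim_col A \<and> j \<in> J}"
  have fin: "finite J" using J finite_subset by blast
  have c: "?c = card J" using J by (intro arg_cong[of _ _ card]) auto
  have "pick J ` {..<?c} = J"
  proof (intro equalityI subsetI)
    fix i assume "i \<in> J"
    \<comment> \<open>Since \<open>pick J\<close> enumerates \<open>J\<close> increasingly from 0,
      the position of \<open>i\<close> is the number of smaller elements of
      \<open>J\<close>.\<close>
    then have "pick J (card {a \<in> J. a < i}) = i" "card {a \<in> J. a < i} < card J"
      using fin by (auto simp: pick_card_in_set intro!: psubset_card_mono)
    then show "i \<in> pick J ` {..<?c}" using c by force
  qed (use c pick_in_set_le in auto)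
  moreover have "set (cols (submatrix A UNIV J)) = col A ` (pick J ` {..<?c})"
    by (auto simp: cols_def dim_submatrix col_submatrix)
  ultimately show ?thesis by simp
qed

section \<open>Rank as a function of the row space\<close>

text \<open>The entries of \<open>A *\<^sub>v x\<close> are the products of \<open>x\<close> with
  the rows, and orthogonality to the rows extends to their span by bilinearity.\<close>

lemma mult_mat_vec_eq_0_iff:
  assumes "A \<in> carrier_mat m n" "x \<in> carrier_vec n"
  shows "A *\<^sub>v x = 0\<^sub>v m \<longleftrightarrow> x \<in> vec_module.orthogonal_complement n (vec_space.row_space n A)"
proof -
  have "A *\<^sub>v x = 0\<^sub>v m \<longleftrightarrow> (\<forall>i<m. row A i \<bullet> x = 0)"
    using assms by (auto simp: vec_eq_iff)
  also have "\<dots> \<longleftrightarrow> (\<forall>y\<in>set (rows A). x \<bullet> y = 0)"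
    using assms by (auto simp: rows_def comm_scalar_prod[of x n])
  also have "\<dots> \<longleftrightarrow> x \<in> vec_module.orthogonal_complement n (set (rows A))"
    using assms by (simp add: vec_module.orthogonal_complement_def)
  also have "\<dots> \<longleftrightarrow> x \<in> vec_module.orthogonal_complement n (vec_space.row_space n A)"
    unfolding vec_space.row_space_def
    using assms by (subst vec_space.in_orthogonal_complement_span) (auto simp: rows_def)
  finally show ?thesis .
qed

lemma mat_rank_nullity:
  fixes A :: "'a::field mat"
  shows "mat_rank A + subspace_dim (dim_col A) (mat_kernel A) = dim_col A"
proof -
  let ?m = "dim_row A" and ?n = "dim_col A"
  interpret n: vec_space "TYPE('a)" ?n .
  interpret m: vec_space "TYPE('a)" ?m .
  have A: "A \<in> carrier_mat ?m ?n" by simp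
  interpret T: linear_map class_ring n.V m.V "\<lambda>x. A *\<^sub>v x"
  proof unfold_locales
    show "(\<lambda>x. A *\<^sub>v x) \<in> LinearCombinations.module_hom class_ring n.V m.V"
      unfolding LinearCombinations.module_hom_def module_vec_simps
      using mult_mat_vec_carrier[OF A] mult_add_distrib_mat_vec[OF A] mult_mat_vec[OF A] by blast
  qed
  have "T.im = m.col_space A"
    unfolding T.im_def m.col_space_eq[OF A]
    using mult_mat_vec_carrier[OF A] by (auto simp: module_vec_simps)
  moreover have "T.ker = mat_kernel A"
    unfolding T.ker_def mat_kernel_def by (auto simp: module_vec_simps)
  ultimately show ?thesis
    using T.rank_nullity[OF n.fin_dim] n.dim_is_n
    by (simp add: m.rank_def m.col_space_def)
qed

lemma mat_rank_eqI:
  assumes "dim_col A = dim_col B" "mat_kernel A = mat_kernel B"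
  shows "mat_rank A = mat_rank B"
  using mat_rank_nullity[of A] mat_rank_nullity[of B] assms by simp

text \<open>\<open>A\<close> and \<open>B\<close> may have different numbers of rows, so their
  column spaces need not lie in one space; the kernels of the submatrices do.\<close>

lemma mat_rank_submatrix_row_space:
  assumes A: "dim_col A = n" and B: "dim_col B = n"
    and row_space: "vec_space.row_space n A = vec_space.row_space n B"
  shows "mat_rank (submatrix A UNIV J) = mat_rank (submatrix B UNIV J)"
proof (rule mat_rank_eqI)
  show "dim_col (submatrix A UNIV J) = dim_col (submatrix B UNIV J)"
    using A B by (simp add: dim_submatrix)
  \<comment> \<open>Multiplication by \<open>?S\<close> from the right selects the columns in
    \<open>J\<close>, and \<open>?S *\<^sub>v x\<close> pads \<open>x\<close> with zeros outside
    \<open>J\<close>. The kernel thus consists of the vectors whose padding is orthogonal to the row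
    space.\<close>
  let ?S = "submatrix (1\<^sub>m n) UNIV J" and ?c = "card {j. j < n \<and> j \<in> J}"
  have S: "?S \<in> carrier_mat n ?c" using submatrix_carrier_mat[of "1\<^sub>m n" J] by simp
  have kernel: "mat_kernel (submatrix C UNIV J) =
      {x \<in> carrier_vec ?c. ?S *\<^sub>v x \<in> vec_module.orthogonal_complement n (vec_space.row_space n C)}"
    if "dim_col C = n" for C :: "'a mat"
  proof -
    have C: "C \<in> carrier_mat (dim_row C) n" using that by auto
    have eq: "submatrix C UNIV J = C * ?S"
      using submatrix_mult_UNIV[of C "1\<^sub>m n" J] C by simp
    have "C * ?S *\<^sub>v x = 0\<^sub>v (dim_row C) \<longleftrightarrow>
        ?S *\<^sub>v x \<in> vec_module.orthogonal_complement n (vec_space.row_space n C)"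
      if x: "x \<in> carrier_vec ?c" for x
      using mult_mat_vec_eq_0_iff[OF C mult_mat_vec_carrier[OF S x]] assoc_mult_mat_vec[OF C S x]
      by simp
    then show ?thesis
      unfolding eq mat_kernel[OF mult_carrier_mat[OF C S]] by blast
  qed
  show "mat_kernel (submatrix A UNIV J) = mat_kernel (submatrix B UNIV J)"
    unfolding kernel[OF A] kernel[OF B] row_space ..
qed

section \<open>Rank in the associated q-matroid\<close>

text \<open>If a column of \<open>Y\<close> is \<open>Z *\<^sub>v x\<close> over the small field,
  the embedded coefficients of \<open>x\<close> express the corresponding column of
  \<open>G * map_mat hom Y\<close> through those of \<open>G * map_mat hom Z\<close>.\<close>

lemma (in field_hom) col_space_mult_map_mat_mono:
  assumes G: "G \<in> carrier_mat k n"
    and Y: "Y \<in> carrier_mat n c" and Z: "Z \<in> carrier_mat n d"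
    and sub: "vec_space.col_space n Y \<subseteq> vec_space.col_space n Z"
  shows "vec_space.col_space k (G * map_mat hom Y) \<subseteq> vec_space.col_space k (G * map_mat hom Z)"
proof -
  interpret k: vec_space "TYPE('b)" k .
  interpret n: vec_space "TYPE('a)" n .
  have GZ: "G * map_mat hom Z \<in> carrier_mat k d" using G Z by auto
  have "col (G * map_mat hom Y) j \<in> k.col_space (G * map_mat hom Z)" if j: "j < c" for j
  proof -
    have "col Y j \<in> n.col_space Y"
      unfolding n.col_space_def using Y j by (intro n.span_mem) (auto simp: cols_def)
    then obtain x where x: "x \<in> carrier_vec d" "col Y j = Z *\<^sub>v x"
      using sub n.col_space_eq[OF Z] Z by auto
    have "col (G * map_mat hom Y) j = G *\<^sub>v map_vec hom (col Y j)"
      using G Y j by auto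
    also have "\<dots> = G *\<^sub>v (map_mat hom Z *\<^sub>v map_vec hom x)"
      unfolding x(2) by (subst mult_mat_vec_hom[OF Z x(1)]) simp
    also have "\<dots> = (G * map_mat hom Z) *\<^sub>v map_vec hom x"
      using G Z x by auto
    finally have "col (G * map_mat hom Y) j = (G * map_mat hom Z) *\<^sub>v map_vec hom x" .
    moreover have "map_vec hom x \<in> carrier_vec (dim_col (G * map_mat hom Z))"
      using x(1) Z by simp
    moreover have "col (G * map_mat hom Y) j \<in> carrier_vec (dim_row (G * map_mat hom Z))"
      using G by (intro carrier_vecI) simp
    ultimately show ?thesis
      unfolding k.col_space_eq[OF GZ] by (metis (mono_tags, lifting) mem_Collect_eq)
  qed
  then have "set (cols (G * map_mat hom Y)) \<subseteq> k.col_space (G * map_mat hom Z)"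
    using Y by (auto simp: cols_def)
  then show ?thesis
    unfolding k.col_space_def[of "G * map_mat hom Y"]
    using G by (intro k.span_is_subset)
      (auto simp: k.col_space_def cols_def intro!: k.span_is_submodule carrier_vecI)
qed

text \<open>Monotonicity in both directions gives the two products the same column space, so
  \<open>Y\<close> may replace the matrix picked by \<open>SOME\<close>.\<close>

lemma (in field_hom) assoc_q_matroid_rank:
  assumes G: "G \<in> carrier_mat k n" and Y: "Y \<in> carrier_mat n c"
  shows "snd (assoc_q_matroid hom G) (vec_space.col_space n Y) = mat_rank (G * map_mat hom Y)"
proof -
  define Z where "Z = (SOME Z. dim_row Z = n \<and> vec_space.col_space n Z = vec_space.col_space n Y)"
  have "dim_row Z = n \<and> vec_space.col_space n Z = vec_space.col_space n Y"
    \<comment> \<open>\<open>Y\<close> itself shows that the choice is possible.\<close>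
    unfolding Z_def by (rule someI[of _ Y]) (use Y in simp)
  then have Z: "Z \<in> carrier_mat n (dim_col Z)" and eq: "vec_space.col_space n Z = vec_space.col_space n Y"
    by auto
  have "vec_space.col_space k (G * map_mat hom Z) = vec_space.col_space k (G * map_mat hom Y)"
    using col_space_mult_map_mat_mono[OF G Y Z] col_space_mult_map_mat_mono[OF G Z Y] eq by auto
  then have "mat_rank (G * map_mat hom Z) = mat_rank (G * map_mat hom Y)"
    using G by (simp add: vec_space.rank_def vec_space.col_space_def)
  then show ?thesis using G by (simp add: assoc_q_matroid_def Let_def Z_def)
qed

lemma (in vec_space) span_Union_span:
  assumes "v ` A \<subseteq> carrier_vec n"
  shows "span (\<Union>j\<in>A. span {v j}) = span (v ` A)"
proof (rule equalityI)
  have sub: "span {v j} \<subseteq> span (v ` A)" if "j \<in> A" for j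
    using that by (intro span_is_monotone) auto
  then show "span (\<Union>j\<in>A. span {v j}) \<subseteq> span (v ` A)"
    using assms by (intro span_is_subset) (auto intro!: span_is_submodule)
  have "v j \<in> span {v j}" if "j \<in> A" for j
    using assms that by (intro span_self) auto
  then have "v ` A \<subseteq> (\<Union>j\<in>A. span {v j})" by blast
  then show "span (v ` A) \<subseteq> span (\<Union>j\<in>A. span {v j})"
    by (rule span_is_monotone)
qed

section \<open>The induced matroid and the equivalence\<close>

text \<open>The rank of a set of columns is the dimension of its span, so the closure criterion
  applies with closure meaning membership of a column in that span.\<close>

lemma is_matroid_induced_matroid: "is_matroid (induced_matroid (G :: 'a::field mat))"
proof -
  interpret vec_space "TYPE('a)" "dim_row G" .
  let ?E = "{..<dim_col G}"
  have rank: "mat_rank (submatrix G UNIV A) = vectorspace.dim class_ring (span_vs (col G ` A))"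
    if "A \<subseteq> ?E" for A
    using set_cols_submatrix[OF that] by (simp add: rank_def dim_submatrix)
  show ?thesis
    unfolding induced_matroid_def
  proof (rule is_matroid_closureI[where cl = "\<lambda>j A. col G j \<in> span (col G ` A)"])
    show "mat_rank (submatrix G UNIV {}) = 0" using rank[of "{}"] dim_span_empty by simp
    show "col G j \<in> span (col G ` B)" if "A \<subseteq> B" "col G j \<in> span (col G ` A)" for A B j
      using that span_is_monotone[of "col G ` A" "col G ` B"] by auto
    show "mat_rank (submatrix G UNIV (insert j A)) = (if col G j \<in> span (col G ` A)
        then mat_rank (submatrix G UNIV A) else Suc (mat_rank (submatrix G UNIV A)))"
      if A: "A \<subseteq> ?E" and j: "j \<in> ?E" for A j
    proof -
      have "finite A" using A finite_subset by blast
      then show ?thesis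
        using dim_span_insert[of "col G ` A" "col G j"] rank[of A] rank[of "insert j A"] A j
        by (simp add: image_subset_iff)
    qed
  qed simp
qed

theorem theorem6p13:
  fixes emb :: "'q::{field,finite} \<Rightarrow> 'e::{field,finite}"
    and C :: "'e vec set" and G G' :: "'e mat" and H :: "'q mat"
    and q m n k N :: nat
  assumes "q = CARD('q)" and "field_hom emb" and "CARD('e) = q ^ m"
    and "is_subspace n C"
    and "G \<in> carrier_mat k n" and "generating_matrix n G C"
    and "N = (q ^ n - 1) div (q - 1)"
    and "H \<in> carrier_mat n N" and "point_representatives n H"
    and "generating_matrix N G' (vec_space.row_space N (G * map_mat emb H))"
  shows "matroid_equiv (projectivization n (assoc_q_matroid emb G)) (induced_matroid G')"
proof -
  interpret emb: field_hom emb by fact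
  interpret n: vec_space "TYPE('q)" n .
  note G = \<open>G \<in> carrier_mat k n\<close> and H = \<open>H \<in> carrier_mat n N\<close>
  let ?GH = "G * map_mat emb H"
  let ?r = "\<lambda>A. mat_rank (submatrix G' UNIV A)"
  let ?s = "snd (projectivization n (assoc_q_matroid emb G))"
  have GH: "dim_col ?GH = N" using H by simp
  have G': "dim_col G' = N" and row: "vec_space.row_space N G' = vec_space.row_space N ?GH"
    using assms(10) by (auto simp: generating_matrix_def)
  have bij: "bij_betw (\<lambda>j. n.span {col H j}) {..<N} (lines_in n (carrier_vec n))"
    using assms(9) H by (simp add: point_representatives_def)
  have rank: "?s ((\<lambda>j. n.span {col H j}) ` A) = ?r A" if A: "A \<subseteq> {..<N}" for A
  proof -
    let ?Y = "submatrix H UNIV A"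
    have "n.span (\<Union> ((\<lambda>j. n.span {col H j}) ` A)) = n.span (col H ` A)"
      using H by (intro n.span_Union_span) auto
    also have "\<dots> = n.col_space ?Y"
      using set_cols_submatrix[of A H] A H by (simp add: n.col_space_def)
    finally have "?s ((\<lambda>j. n.span {col H j}) ` A) = snd (assoc_q_matroid emb G) (n.col_space ?Y)"
      by (simp add: projectivization_def)
    also have "\<dots> = mat_rank (G * map_mat emb ?Y)"
      using emb.assoc_q_matroid_rank[OF G] submatrix_carrier_mat[of H A] H by auto
    also have "G * map_mat emb ?Y = submatrix ?GH UNIV A"
      by (simp add: map_mat_submatrix submatrix_mult_UNIV)
    \<comment> \<open>Here \<open>G'\<close> replaces \<open>?GH\<close>, from which it may differ
      in the number of rows.\<close>
    also have "mat_rank \<dots> = ?r A"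
      using mat_rank_submatrix_row_space[OF GH G' row[symmetric]] .
    finally show ?thesis .
  qed
  have "is_matroid ({..<N}, ?r)"
    using is_matroid_induced_matroid[of G'] G' by (simp add: induced_matroid_def)
  from matroid_equiv_bijI[OF this bij, of ?s, OF rank] show ?thesis
    using G G' by (simp add: induced_matroid_def projectivization_def assoc_q_matroid_def Let_def)
qed

end
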